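(* Let $(X,\mathcal{A},\mu,T)$ be a measure preserving system and let $f:X\to\mathbb{R}^N$ be a measurable function. Then, for $\mu$-almost every $x\in X$, \[\underline{R}^f(x)\leq\underline{d}^f_\mu(x)\qquad\text{and}\qquad\overline{R}^f(x)\leq\overline{d}^f_\mu(x).\]
   Context: A measure preserving system $(X,\mathcal{A},\mu,T)$ consists of a set $X$ with a $\sigma$-algebra $\mathcal{A}$, a measure $\mu$ on $(X,\mathcal{A})$ with $\mu(X)=1$, and a measurable map $T:X\to X$ such that $\mu(T^{-1}A)=\mu(A)$ for all $A\in\mathcal{A}$. $B(y,r)$ is the open ball with center $y$ and radius $r$ in $\mathbb{R}^N$, with respect to the Euclidean distance. For $f:X\to\mathbb{R}^N$ measurable, $x\in X$, $r>0$, $p\in\mathbb{N}$, the $p$-non-instantaneous return time for the observation is \[\tau^f_{r,p}(x):=\inf\{k>p : k\in\mathbb{N},\ f(T^kx)\in B(f(x),r)\}\] (with $\inf\emptyset=+\infty$, $\log(+\infty)=+\infty$), and the non-instantaneous lower and upper recurrence rates for the observation are \[\underline{R}^f(x):=\lim_{p\to\infty}\liminf_{r\to0}\frac{\log\tau^f_{r,p}(x)}{-\log r},\qquad \overline{R}^f(x):=\lim_{p\to\infty}\limsup_{r\to0}\frac{\log\tau^f_{r,p}(x)}{-\log r}\] (the limits in $p$ are monotone). The lower and upper pointwise dimensions of a Borel probability measure $\nu$ on $\mathbb{R}^N$ at $y$ are \[\underline{d}_\nu(y)=\liminf_{r\to0}\frac{\log\nu(B(y,r))}{\log r},\qquad \overline{d}_\nu(y)=\limsup_{r\to0}\frac{\log\nu(B(y,r))}{\log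 r}.\] With the pushforward $f_*\mu(\cdot):=\mu(f^{-1}(\cdot))$, set $\underline{d}^f_\mu(x)=\underline{d}_{f_*\mu}(f(x))$ and $\overline{d}^f_\mu(x)=\overline{d}_{f_*\mu}(f(x))$. *)

theory Defs
  imports "HOL-Probability.Probability"
begin

locale measure_preserving_system = prob_space M
  for M :: "'a measure" and T :: "'a \<Rightarrow> 'a" +
  assumes T_measurable: "T \<in> measurable M M"
    and T_preserves: "\<And>A. A \<in> sets M \<Longrightarrow> emeasure M (T -` A \<inter> space M) = emeasure M A"

text \<open>The logarithm on \<open>[0, \<infinity>]\<close>, with \<open>log 0 = -\<infinity>\<close> and \<open>log \<infinity> = \<infinity>\<close>
  (values at negative arguments are irrelevant).\<close>

definition eln :: "ereal \<Rightarrow> ereal" where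
  "eln x = (if x \<le> 0 then -\<infinity> else if x = \<infinity> then \<infinity> else ereal (ln (real_of_ereal x)))"

text \<open>In \<^typ>\<open>enat\<close> the infimum of the empty set is \<open>\<infinity>\<close>.\<close>

definition return_time ::
    "('a \<Rightarrow> 'a) \<Rightarrow> ('a \<Rightarrow> real ^ 'n) \<Rightarrow> real \<Rightarrow> nat \<Rightarrow> 'a \<Rightarrow> enat" where
  "return_time T f r p x = Inf {enat k | k. k > p \<and> f ((T ^^ k) x) \<in> ball (f x) r}"

definition lower_recurrence_rate_from ::
    "('a \<Rightarrow> 'a) \<Rightarrow> ('a \<Rightarrow> real ^ 'n) \<Rightarrow> nat \<Rightarrow> 'a \<Rightarrow> ereal" where
  "lower_recurrence_rate_from T f p x =
     Liminf (at_right 0) (\<lambda>r. eln (ereal_of_enat (return_time T f r p x)) / ereal (- ln r))"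

definition upper_recurrence_rate_from ::
    "('a \<Rightarrow> 'a) \<Rightarrow> ('a \<Rightarrow> real ^ 'n) \<Rightarrow> nat \<Rightarrow> 'a \<Rightarrow> ereal" where
  "upper_recurrence_rate_from T f p x =
     Limsup (at_right 0) (\<lambda>r. eln (ereal_of_enat (return_time T f r p x)) / ereal (- ln r))"

definition lower_recurrence_rate ::
    "('a \<Rightarrow> 'a) \<Rightarrow> ('a \<Rightarrow> real ^ 'n) \<Rightarrow> 'a \<Rightarrow> ereal" where
  "lower_recurrence_rate T f x = lim (\<lambda>p. lower_recurrence_rate_from T f p x)"

definition upper_recurrence_rate ::
    "('a \<Rightarrow> 'a) \<Rightarrow> ('a \<Rightarrow> real ^ 'n) \<Rightarrow> 'a \<Rightarrow> ereal" where
  "upper_recurrence_rate T f x = lim (\<lambda>p. upper_recurrence_rate_from T f p x)"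

definition lower_pointwise_dim :: "(real ^ 'n) measure \<Rightarrow> real ^ 'n \<Rightarrow> ereal" where
  "lower_pointwise_dim \<nu> y =
     Liminf (at_right 0) (\<lambda>r. eln (ereal (measure \<nu> (ball y r))) / ereal (ln r))"

definition upper_pointwise_dim :: "(real ^ 'n) measure \<Rightarrow> real ^ 'n \<Rightarrow> ereal" where
  "upper_pointwise_dim \<nu> y =
     Limsup (at_right 0) (\<lambda>r. eln (ereal (measure \<nu> (ball y r))) / ereal (ln r))"

definition lower_dim_obs :: "'a measure \<Rightarrow> ('a \<Rightarrow> real ^ 'n) \<Rightarrow> 'a \<Rightarrow> ereal" where
  "lower_dim_obs M f x = lower_pointwise_dim (distr M borel f) (f x)"

definition upper_dim_obs :: "'a measure \<Rightarrow> ('a \<Rightarrow> real ^ 'n) \<Rightarrow> 'a \<Rightarrow> ereal" where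
  "upper_dim_obs M f x = upper_pointwise_dim (distr M borel f) (f x)"

text \<open>The limits in \<open>p\<close> are monotone, hence they exist and \<^const>\<open>lim\<close> is meaningful.\<close>

lemma eln_mono: "x \<le> y \<Longrightarrow> eln x \<le> eln y"
  by (cases x; cases y) (auto simp: eln_def)

lemma return_time_mono: "p \<le> q \<Longrightarrow> return_time T f r p x \<le> return_time T f r q x"
  unfolding return_time_def by (rule Inf_superset_mono) auto

lemma recurrence_quotient_mono:
  assumes "p \<le> q"
  shows "\<forall>\<^sub>F r in at_right 0. eln (ereal_of_enat (return_time T f r p x)) / ereal (- ln r)
           \<le> eln (ereal_of_enat (return_time T f r q x)) / ereal (- ln r)"
proof -
  have "\<forall>\<^sub>F r in at_right 0. r \<in> {0<..<1::real}"
    by (rule eventually_at_right_real) simp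
  then show ?thesis
    by eventually_elim
      (auto intro!: ereal_divide_right_mono eln_mono return_time_mono assms
        simp: ereal_of_enat_le_iff)
qed

lemma lower_recurrence_rate_tendsto:
  "(\<lambda>p. lower_recurrence_rate_from T f p x) \<longlonglongrightarrow> lower_recurrence_rate T f x"
proof -
  have "incseq (\<lambda>p. lower_recurrence_rate_from T f p x)"
    unfolding incseq_def lower_recurrence_rate_from_def
    by (intro allI impI Liminf_mono recurrence_quotient_mono)
  from LIMSEQ_SUP[OF this] show ?thesis
    unfolding lower_recurrence_rate_def by (simp add: limI)
qed

lemma upper_recurrence_rate_tendsto:
  "(\<lambda>p. upper_recurrence_rate_from T f p x) \<longlonglongrightarrow> upper_recurrence_rate T f x"
proof -
  have "incseq (\<lambda>p. upper_recurrence_rate_from T f p x)"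
    unfolding incseq_def upper_recurrence_rate_from_def
    by (intro allI impI Limsup_mono recurrence_quotient_mono)
  from LIMSEQ_SUP[OF this] show ?thesis
    unfolding upper_recurrence_rate_def by (simp add: limI)
qed

end

theory Submission
  imports Defs
begin

text \<open>At scale \<open>r\<close>, partition \<open>\<real>\<^sup>N\<close> into cubes of diameter below \<open>r\<close>. If no \<open>k\<close> with \<open>p < k \<le> L\<close> brings the
  points of a set \<open>E\<close> back to the cell of \<open>E\<close>, then about \<open>L / (p + 1)\<close> preimages of \<open>E\<close> are disjoint,
  so \<open>E\<close> has measure at most \<open>(p + 1) / L\<close>. Take \<open>L = r powr - \<epsilon> / a\<close>, where \<open>a\<close> is the mass of the
  neighbouring cells, which cover every ball of radius \<open>r\<close> centred in the cell. Since each cell is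
  counted boundedly often as a neighbour, the points returning late have total measure
  \<open>O(r powr \<epsilon>)\<close>, which is summable over dyadic \<open>r\<close>. By Borel--Cantelli, almost surely
  \<open>\<tau> * \<nu> (B (f x) r) \<le> r powr - \<epsilon>\<close> for all small \<open>r\<close>; take logarithms.\<close>

section \<open>Iterates of \<open>T\<close> and sets without early return\<close>

context measure_preserving_system
begin

lemma funpow_measurable: "T ^^ k \<in> measurable M M"
proof (induction k)
  case (Suc k)
  then show ?case
    using measurable_comp[OF Suc T_measurable] by (simp only: funpow.simps)
qed (simp add: id_def)

lemma emeasure_funpow_vimage:
  assumes "A \<in> sets M"
  shows "emeasure M ((T ^^ k) -` A \<inter> space M) = emeasure M A"
proof (induction k)
  case 0
  show ?case using assms sets.sets_into_space by (simp add: Int_absorb2)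
next
  case (Suc k)
  have *: "T ` space M \<subseteq> space M"
    using measurable_space[OF T_measurable] by auto
  have "(T ^^ Suc k) -` A \<inter> space M = T -` ((T ^^ k) -` A \<inter> space M) \<inter> space M"
    using * by (auto simp: funpow_Suc_right simp del: funpow.simps)
  then show ?case
    using Suc.IH T_preserves[OF measurable_sets[OF funpow_measurable assms]] by (simp only:)
qed

text \<open>The preimages of \<open>E\<close> under \<open>T ^^ (i * Suc p)\<close>, \<open>i \<le> m\<close>, are disjoint.\<close>

lemma measure_no_return_le:
  assumes E: "E \<in> sets M"
    and no_return: "\<And>x k. x \<in> E \<Longrightarrow> p < k \<Longrightarrow> k \<le> m * Suc p \<Longrightarrow> (T ^^ k) x \<notin> E"
  shows "real (Suc m) * measure M E \<le> 1"
proof -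
  let ?F = "\<lambda>i. (T ^^ (i * Suc p)) -` E \<inter> space M"
  have F: "?F i \<in> sets M" for i
    by (rule measurable_sets[OF funpow_measurable E])
  \<comment> \<open>A common point would be carried into \<open>E\<close> at time
    \<open>i * Suc p\<close> and again at time \<open>j * Suc p\<close>. The gap is a positive
    multiple of \<open>Suc p\<close>, hence exceeds \<open>p\<close>, and is at most
    \<open>m * Suc p\<close>, which \<open>no_return\<close> forbids.\<close>
  have sep: "?F i \<inter> ?F j = {}" if "i < j" "j \<le> m" for i j
  proof -
    obtain d where d: "j = i + Suc d"
      using \<open>i < j\<close> less_iff_Suc_add by (metis add_Suc_right)
    have "j * Suc p = Suc d * Suc p + i * Suc p"
      unfolding d by (simp add: algebra_simps)
    then have "(T ^^ (j * Suc p)) x = (T ^^ (Suc d * Suc p)) ((T ^^ (i * Suc p)) x)" for x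
      by (simp only: funpow_add comp_apply)
    moreover have "p < Suc d * Suc p"
      by simp
    moreover have "Suc d * Suc p \<le> m * Suc p"
      using d \<open>j \<le> m\<close> by (intro mult_le_mono1) simp
    ultimately show ?thesis
      using no_return by (auto simp del: mult_Suc mult_Suc_right)
  qed
  have disj: "disjoint_family_on ?F {..m}"
    unfolding disjoint_family_on_def
  proof (intro ballI impI)
    fix i j assume "i \<in> {..m}" "j \<in> {..m}" "i \<noteq> j"
    then show "?F i \<inter> ?F j = {}"
      using sep[of i j] sep[of j i] by (cases "i < j") auto
  qed
  have "measure M (?F i) = measure M E" for i
    using emeasure_funpow_vimage[OF E] by (simp add: measure_def)
  then have "real (Suc m) * measure M E = (\<Sum>i\<le>m. measure M (?F i))"
    by simp
  also have "\<dots> = measure M (\<Union>i\<le>m. ?F i)"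
    using F disj by (intro finite_measure_finite_Union[symmetric]) auto
  finally show ?thesis
    using prob_le_1 by simp
qed

section \<open>Late returns to the cells of a countable partition\<close>

context
  fixes g :: "'a \<Rightarrow> 'c :: {countable, ab_group_add}" and D :: "'c set"
  assumes g: "g \<in> measurable M (count_space UNIV)"
    and D: "finite D" "0 \<in> D"
begin

lemma g_pred: "{x \<in> space M. P (g x)} \<in> sets M"
  using measurable_sets[OF g, of "{z. P z}"] by (simp add: vimage_def Int_def conj_commute)

text \<open>A point \<open>x\<close> lies in the neighbourhood of \<open>z\<close> only for
  \<open>z = g x - d\<close> with \<open>d\<close> in \<open>D\<close>, so it is counted
  \<open>card D\<close> times, however many cells there are. For fixed \<open>d\<close> the sets
  over all \<open>z\<close> are disjoint and contribute at most 1.\<close>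

lemma nn_integral_neighbourhoods_le:
  "(\<integral>\<^sup>+z. emeasure M {x \<in> space M. g x - z \<in> D} \<partial>count_space UNIV) \<le> of_nat (card D)"
proof -
  have "emeasure M {x \<in> space M. g x - z \<in> D} \<le> (\<Sum>d\<in>D. emeasure M {x \<in> space M. g x - z = d})" for z
  proof -
    have "{x \<in> space M. g x - z \<in> D} = (\<Union>d\<in>D. {x \<in> space M. g x - z = d})"
      by auto
    then show ?thesis
      using g_pred[of "\<lambda>w. w - z = _"] D by (auto intro!: emeasure_subadditive_finite)
  qed
  then have "(\<integral>\<^sup>+z. emeasure M {x \<in> space M. g x - z \<in> D} \<partial>count_space UNIV)
      \<le> (\<integral>\<^sup>+z. (\<Sum>d\<in>D. emeasure M {x \<in> space M. g x - z = d}) \<partial>count_space UNIV)"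
    by (intro nn_integral_mono) auto
  also have "\<dots> = (\<Sum>d\<in>D. \<integral>\<^sup>+z. emeasure M {x \<in> space M. g x - z = d} \<partial>count_space UNIV)"
    by (rule nn_integral_sum) auto
  also have "\<dots> = (\<Sum>d\<in>D. emeasure M (\<Union>z. {x \<in> space M. g x - z = d}))"
    by (intro sum.cong refl emeasure_UN_countable[symmetric])
      (auto simp: disjoint_family_on_def g_pred[of "\<lambda>w. w - _ = _"])
  also have "\<dots> \<le> (\<Sum>d\<in>D. 1)"
    by (intro sum_mono emeasure_le_1)
  finally show ?thesis
    by simp
qed

text \<open>\<open>K\<close> stands for \<open>r powr - \<epsilon>\<close>. Letting the deadline
  \<open>K / a (g x)\<close> vary with the cell makes the bound for each cell proportional to its
  neighbourhood mass \<open>a z\<close>, and these masses have sum at most \<open>card D\<close>.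
  The product form \<open>real k * a (g x) \<le> K\<close> also makes sense when the mass is 0: then
  every \<open>k\<close> is before the deadline.\<close>

lemma late_return:
  fixes K :: real and p :: nat
  assumes K: "K > 0"
  defines "a \<equiv> \<lambda>z. measure M {x \<in> space M. g x - z \<in> D}"
  defines "B \<equiv> {x \<in> space M. \<forall>k>p. real k * a (g x) \<le> K \<longrightarrow> g ((T ^^ k) x) \<noteq> g x}"
  shows late_return_sets: "B \<in> sets M"
    and measure_late_return_le: "measure M B \<le> real (Suc p) * real (card D) / K"
proof -
  \<comment> \<open>Fixing the cell \<open>z\<close> freezes the deadline, so that
    \<open>measure_no_return_le\<close> applies to each piece \<open>E z\<close>.\<close>
  define E where
    "E z = {x \<in> space M. g x = z \<and> (\<forall>k\<in>{k. p < k \<and> real k * a z \<le> K}. g ((T ^^ k) x) \<noteq> z)}" for z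
  have B_eq: "B = (\<Union>z. E z)"
    by (auto simp: B_def E_def)
  have E: "E z \<in> sets M" for z
  proof -
    have [measurable]: "(\<lambda>x. g ((T ^^ k) x)) \<in> measurable M (count_space UNIV)" for k
      by (rule measurable_compose[OF funpow_measurable g])
    note g[measurable]
    show ?thesis
      unfolding E_def by measurable
  qed
  have E_le: "measure M (E z) \<le> real (Suc p) / K * a z" for z
  proof (cases "a z = 0")
    \<comment> \<open>No deadline exists here, but \<open>0 \<in> D\<close> places
      \<open>E z\<close> inside its own neighbourhood, which is null.\<close>
    case True
    have "measure M (E z) \<le> a z"
      unfolding a_def using D
      by (intro finite_measure_mono) (auto simp: E_def g_pred[of "\<lambda>w. w - z \<in> D"])
    then show ?thesis
      using True by simp
  next
    case False
    then have a: "a z > 0"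
      by (simp add: a_def zero_less_measure_iff)
    \<comment> \<open>The largest \<open>m\<close> for which all times up to
      \<open>m * Suc p\<close> are before the deadline. The loss from rounding down is made up by
      the factor \<open>Suc m\<close> in \<open>measure_no_return_le\<close>.\<close>
    define m where "m = nat \<lfloor>K / (a z * real (Suc p))\<rfloor>"
    have q: "K / (a z * real (Suc p)) \<ge> 0"
      using a K by simp
    have m: "real m \<le> K / (a z * real (Suc p))" "K / (a z * real (Suc p)) \<le> real (Suc m)"
      unfolding m_def using q by linarith+
    have "real (Suc m) * measure M (E z) \<le> 1"
    proof (rule measure_no_return_le[OF E, where p = p])
      fix x k assume x: "x \<in> E z" and k: "p < k" "k \<le> m * Suc p"
      have "real k \<le> real m * real (Suc p)"
        using k(2) by (metis of_nat_le_iff of_nat_mult)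
      then have "real k * a z \<le> real m * real (Suc p) * a z"
        using a by (intro mult_right_mono) auto
      also have "\<dots> \<le> K"
        using m(1) a by (simp add: pos_le_divide_eq mult_ac del: of_nat_Suc)
      finally show "(T ^^ k) x \<notin> E z"
        using x k by (auto simp: E_def)
    qed
    then have "K / (a z * real (Suc p)) * measure M (E z) \<le> 1"
      using mult_right_mono[OF m(2) measure_nonneg[of M "E z"]] by linarith
    then show ?thesis
      using a K by (simp add: pos_divide_le_eq pos_le_divide_eq mult_ac del: of_nat_Suc)
  qed
  show "B \<in> sets M"
    unfolding B_eq using E by (intro sets.countable_UN') auto
  have "emeasure M B = (\<integral>\<^sup>+z. emeasure M (E z) \<partial>count_space UNIV)"
    unfolding B_eq using E
    by (intro emeasure_UN_countable) (auto simp: disjoint_family_on_def E_def)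
  also have "\<dots> \<le> (\<integral>\<^sup>+z. ennreal (real (Suc p) / K) * emeasure M {x \<in> space M. g x - z \<in> D} \<partial>count_space UNIV)"
    using E_le K
    by (intro nn_integral_mono)
      (simp add: emeasure_eq_measure a_def ennreal_mult[symmetric] ennreal_leI)
  also have "\<dots> = ennreal (real (Suc p) / K) * (\<integral>\<^sup>+z. emeasure M {x \<in> space M. g x - z \<in> D} \<partial>count_space UNIV)"
    by (rule nn_integral_cmult) simp
  also have "\<dots> \<le> ennreal (real (Suc p) / K) * of_nat (card D)"
    by (intro mult_left_mono nn_integral_neighbourhoods_le) simp
  also have "\<dots> = ennreal (real (Suc p) * real (card D) / K)"
    using K by (simp add: ennreal_of_nat_eq_real_of_nat ennreal_mult[symmetric])
  finally show "measure M B \<le> real (Suc p) * real (card D) / K"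
    using K by (simp add: emeasure_eq_measure)
qed

end

end

section \<open>Cubes of side \<open>1 / c\<close> and their neighbours\<close>

definition grid_cell :: "real \<Rightarrow> real ^ 'n \<Rightarrow> int ^ 'n" where
  "grid_cell c y = (\<chi> i. \<lfloor>c * y $ i\<rfloor>)"

lemma grid_cell_measurable: "grid_cell c \<in> measurable borel (count_space UNIV)"
proof (subst measurable_count_space_eq_countable, simp, intro conjI ballI)
  show "grid_cell c \<in> space borel \<rightarrow> (UNIV :: (int ^ 'n) set)"
    by simp
  fix z :: "int ^ 'n"
  have "grid_cell c -` {z} \<inter> space borel
    = {y \<in> space borel. \<forall>i\<in>UNIV. \<lfloor>c * y $ i\<rfloor> = z $ i}"
    by (auto simp: grid_cell_def vec_eq_iff)
  also have "\<dots> \<in> sets borel"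
    by measurable
  finally show "grid_cell c -` {z} \<inter> space borel \<in> sets borel" .
qed

text \<open>Each coordinate differs by less than \<open>1 / c\<close>, and the Euclidean norm is at
  most the sum of the absolute coordinates.\<close>

lemma dist_less_if_same_grid_cell:
  fixes x y :: "real ^ 'n"
  assumes "grid_cell c x = grid_cell c y" "c > 0"
  shows "dist x y < real CARD('n) / c"
proof -
  have "\<bar>(x - y) $ i\<bar> < 1 / c" for i
  proof -
    have "\<lfloor>c * x $ i\<rfloor> = \<lfloor>c * y $ i\<rfloor>"
      using assms(1) by (simp add: grid_cell_def vec_eq_iff)
    then have "\<bar>c * x $ i - c * y $ i\<bar> < 1"
      by linarith
    then have "c * \<bar>x $ i - y $ i\<bar> < 1"
      using \<open>c > 0\<close> by (simp add: abs_mult right_diff_distrib[symmetric])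
    then show ?thesis
      using \<open>c > 0\<close> by (simp add: field_simps)
  qed
  then have "(\<Sum>i\<in>UNIV. \<bar>(x - y) $ i\<bar>) < (\<Sum>i\<in>(UNIV :: 'n set). 1 / c)"
    by (intro sum_strict_mono) auto
  then show ?thesis
    using norm_le_l1_cart[of "x - y"] by (simp add: dist_norm)
qed

text \<open>The integer points of a sup-norm ball, serving as offsets from a cell to its
  neighbours.\<close>

definition grid_box :: "nat \<Rightarrow> (int ^ 'n) set" where
  "grid_box m = {d. \<forall>i. \<bar>d $ i\<bar> \<le> int m}"

lemma zero_in_grid_box: "0 \<in> grid_box m"
  by (simp add: grid_box_def)

lemma finite_grid_box: "finite (grid_box m :: (int ^ 'n) set)"
proof -
  have "grid_box m \<subseteq> vec_lambda ` (PiE UNIV (\<lambda>_. {- int m..int m}) :: ('n \<Rightarrow> int) set)"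
  proof
    fix d :: "int ^ 'n" assume "d \<in> grid_box m"
    then have "vec_nth d \<in> PiE UNIV (\<lambda>_. {- int m..int m})"
      by (auto simp: grid_box_def abs_le_iff minus_le_iff)
    then show "d \<in> vec_lambda ` PiE UNIV (\<lambda>_. {- int m..int m})"
      by (metis image_eqI vec_nth_inverse)
  qed
  then show ?thesis
    by (rule finite_subset) (intro finite_imageI finite_PiE, auto)
qed

text \<open>The floors of two reals less than \<open>m\<close> apart differ by an integer below
  \<open>m + 1\<close>.\<close>

lemma grid_cell_diff_in_grid_box:
  fixes x y :: "real ^ 'n"
  assumes "dist x y < r" "c > 0" "c * r \<le> real m"
  shows "grid_cell c x - grid_cell c y \<in> grid_box m"
proof -
  have "\<bar>\<lfloor>c * x $ i\<rfloor> - \<lfloor>c * y $ i\<rfloor>\<bar> \<le> int m" for i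
  proof -
    have "\<bar>x $ i - y $ i\<bar> < r"
      using component_le_norm_cart[of "x - y" i] assms(1) by (simp add: dist_norm)
    then have "c * \<bar>x $ i - y $ i\<bar> < c * r"
      using \<open>c > 0\<close> by simp
    with assms(3) have "c * \<bar>x $ i - y $ i\<bar> < real m"
      by linarith
    then have "\<bar>c * x $ i - c * y $ i\<bar> < real m"
      using assms(2,3) by (simp add: abs_mult right_diff_distrib[symmetric])
    then show ?thesis
      by linarith
  qed
  then show ?thesis
    by (simp add: grid_box_def grid_cell_def)
qed

section \<open>Dyadic scales and Borel-Cantelli\<close>

lemma dyadic_scale:
  fixes r :: real
  assumes "0 < r" "r \<le> 1 / 2 ^ n0"
  obtains n where "n \<ge> n0" "1 / 2 ^ Suc n \<le> r" "r \<le> 1 / 2 ^ n"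
proof -
  have "\<exists>n. 1 / 2 ^ n < r"
    using real_arch_pow_inv[OF \<open>0 < r\<close>, of "1/2"] by (simp add: power_one_over)
  \<comment> \<open>\<open>1 / 2 ^ k\<close> is the first power below \<open>r\<close>, so its
    predecessor still bounds \<open>r\<close> from above; \<open>n\<close> will be
    \<open>k - 1\<close>.\<close>
  define k where "k = (LEAST n. 1 / 2 ^ n < r)"
  have k: "1 / 2 ^ k < r"
    unfolding k_def by (rule LeastI_ex) fact
  have min: "r \<le> 1 / 2 ^ n" if "n < k" for n
    using not_less_Least[of n "\<lambda>n. 1 / 2 ^ n < r"] that by (auto simp: k_def)
  have "n0 < k"
  proof (rule ccontr)
    assume "\<not> n0 < k"
    then have "1 / 2 ^ n0 \<le> (1 / 2 ^ k :: real)"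
      by (intro divide_left_mono power_increasing) auto
    then show False
      using k assms by linarith
  qed
  then obtain n where "k = Suc n"
    by (cases k) auto
  then show ?thesis
    using k min[of n] \<open>n0 < k\<close> by (intro that[of n]) auto
qed

text \<open>One grid serves all \<open>r\<close> between \<open>1 / 2 ^ Suc n\<close> and
  \<open>1 / 2 ^ n\<close>: its cells have diameter at most the lower end, so a return to the cell
  is a return to the ball, while the neighbourhoods cover balls of radius up to the upper
  end.\<close>

lemma (in measure_preserving_system) return_time_measure_ball:
  fixes f :: "'a \<Rightarrow> real ^ 'n"
  assumes f: "f \<in> borel_measurable M" and \<epsilon>: "\<epsilon> > 0"
  shows "AE x in M. \<forall>\<^sub>F r in at_right 0. \<exists>k>p. f ((T ^^ k) x) \<in> ball (f x) r \<and>
           real k * measure (distr M borel f) (ball (f x) r) \<le> r powr - \<epsilon>"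
proof -
  define N where "N = CARD('n)"
  \<comment> \<open>With \<open>c n\<close> below, \<open>N / c n = 1 / 2 ^ Suc n\<close> bounds the
    cell diameter, and a radius \<open>1 / 2 ^ n\<close> spans \<open>c n / 2 ^ n = 2 * N\<close>
    cell sides. Thus \<open>D\<close>, and with it \<open>card D\<close>, is the same at every
    scale.\<close>
  define D where "D = (grid_box (2 * N) :: (int ^ 'n) set)"
  define c where "c n = real N * 2 ^ Suc n" for n
  define g where "g n x = grid_cell (c n) (f x)" for n x
  define a where "a n z = measure M {x \<in> space M. g n x - z \<in> D}" for n z
  \<comment> \<open>\<open>K n = (2 ^ n) powr \<epsilon>\<close> is at most
    \<open>r powr - \<epsilon>\<close> whenever \<open>0 < r \<le> 1 / 2 ^ n\<close>, and its
    reciprocals form a convergent geometric series.\<close>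
  define K where "K n = (2 powr \<epsilon>) ^ n" for n :: nat
  define B where "B n = {x \<in> space M. \<forall>k>p. real k * a n (g n x) \<le> K n
                           \<longrightarrow> g n ((T ^^ k) x) \<noteq> g n x}" for n
  have N: "N > 0"
    by (simp add: N_def)
  then have c: "c n > 0" for n
    by (simp add: c_def)
  have g: "g n \<in> measurable M (count_space UNIV)" for n
    unfolding g_def by (rule measurable_compose[OF f grid_cell_measurable])
  have D: "finite D" "0 \<in> D"
    by (simp_all add: D_def finite_grid_box zero_in_grid_box)
  have K: "K n > 0" for n
    by (simp add: K_def)
  have B: "B n \<in> sets M" "measure M (B n) \<le> real (Suc p) * real (card D) / K n" for n
    unfolding B_def a_def by (rule late_return_sets[OF g D K] measure_late_return_le[OF g D K])+
  have "2 powr \<epsilon> > 1"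
    using \<epsilon> by simp
  then have "summable (\<lambda>n. real (Suc p) * real (card D) * (1 / 2 powr \<epsilon>) ^ n)"
    by (intro summable_mult summable_geometric) simp
  then have "summable (\<lambda>n. measure M (B n))"
  proof (rule summable_comparison_test'[where N = 0])
    fix n
    have "real (Suc p) * real (card D) / K n = real (Suc p) * real (card D) * (1 / 2 powr \<epsilon>) ^ n"
      by (simp only: K_def power_one_over times_divide_eq_right mult_1_right)
    then show "norm (measure M (B n)) \<le> real (Suc p) * real (card D) * (1 / 2 powr \<epsilon>) ^ n"
      using B(2)[of n] by simp
  qed
  then have "AE x in M. \<forall>\<^sub>F n in sequentially. x \<in> space M - B n"
    using B(1) by (intro borel_cantelli_AE1) (auto simp: emeasure_eq_measure)
  then show ?thesis
  proof eventually_elim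
    case (elim x)
    then obtain n0 where n0: "\<And>n. n \<ge> n0 \<Longrightarrow> x \<in> space M - B n"
      by (auto simp: eventually_sequentially)
    have "\<forall>\<^sub>F r in at_right 0. r \<in> {0<..<1 / 2 ^ n0 :: real}"
      by (rule eventually_at_right_real) simp
    then show ?case
    proof eventually_elim
      case (elim r)
      then obtain n where n: "n \<ge> n0" "1 / 2 ^ Suc n \<le> r" "r \<le> 1 / 2 ^ n"
        using dyadic_scale[of r n0] by auto
      then obtain k where k: "k > p" "real k * a n (g n x) \<le> K n" "g n ((T ^^ k) x) = g n x"
        using n0[of n] by (auto simp: B_def)
      have "dist (f x) (f ((T ^^ k) x)) < real N / c n"
        unfolding N_def using k(3) c by (intro dist_less_if_same_grid_cell) (auto simp: g_def)
      also have "\<dots> = 1 / 2 ^ Suc n"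
        using N by (simp add: c_def)
      finally have in_ball: "f ((T ^^ k) x) \<in> ball (f x) r"
        using n(2) by simp
      have "c n * r \<le> c n * (1 / 2 ^ n)"
        using n(3) c[of n] by (intro mult_left_mono) auto
      also have "\<dots> = real (2 * N)"
        by (simp add: c_def)
      finally have cr: "c n * r \<le> real (2 * N)" .
      have "measure (distr M borel f) (ball (f x) r) = measure M (f -` ball (f x) r \<inter> space M)"
        using f by (intro measure_distr) auto
      also have "\<dots> \<le> a n (g n x)"
        unfolding a_def
      proof (rule finite_measure_mono)
        show "f -` ball (f x) r \<inter> space M \<subseteq> {y \<in> space M. g n y - g n x \<in> D}"
          using grid_cell_diff_in_grid_box[OF _ c cr]
          by (auto simp: g_def D_def dist_commute)
        show "{y \<in> space M. g n y - g n x \<in> D} \<in> sets M"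
          by (rule g_pred[OF g D])
      qed
      finally have "real k * measure (distr M borel f) (ball (f x) r) \<le> real k * a n (g n x)"
        by (intro mult_left_mono) auto
      also have "\<dots> \<le> K n"
        by fact
      also have "\<dots> = (2 ^ n) powr \<epsilon>"
        by (simp add: K_def powr_realpow[symmetric] powr_powr mult.commute)
      also have "\<dots> \<le> (1 / r) powr \<epsilon>"
        using n(3) elim \<epsilon> by (intro powr_mono2) (auto simp: field_simps)
      also have "\<dots> = r powr - \<epsilon>"
        using elim by (simp add: powr_minus_divide powr_divide)
      finally show ?case
        using k(1) in_ball by auto
    qed
  qed
qed

section \<open>From return times to recurrence rates\<close>

lemma recurrence_quotient_le:
  fixes f :: "'a \<Rightarrow> real ^ 'n"
  assumes r: "0 < r" "r < 1"
    and k: "k > p" "f ((T ^^ k) x) \<in> ball (f x) r" "real k * b \<le> r powr - \<epsilon>" and b: "b \<ge> 0"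
  shows "eln (ereal_of_enat (return_time T f r p x)) / ereal (- ln r)
           \<le> eln (ereal b) / ereal (ln r) + ereal \<epsilon>"
proof (cases "b = 0")
  \<comment> \<open>\<open>eln 0\<close> is \<open>-\<infinity>\<close> and \<open>ln r\<close> is
    negative, so the right-hand side is \<open>\<infinity>\<close>.\<close>
  case True
  then show ?thesis
    using r by (simp add: eln_def ereal_divide_eq zero_ereal_def)
next
  case False
  with b have b: "b > 0"
    by simp
  have l: "- ln r > 0"
    using r by simp
  have "return_time T f r p x \<le> enat k"
    unfolding return_time_def using k by (auto intro!: Inf_lower)
  then have "eln (ereal_of_enat (return_time T f r p x)) \<le> eln (ereal_of_enat (enat k))"
    by (intro eln_mono) (simp only: ereal_of_enat_le_iff)
  \<comment> \<open>\<open>k > p\<close> excludes \<open>k = 0\<close>, where \<open>eln\<close>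
    would be \<open>-\<infinity>\<close>.\<close>
  also have "\<dots> = ereal (ln (real k))"
    using k by (simp add: eln_def)
  finally have "eln (ereal_of_enat (return_time T f r p x)) / ereal (- ln r)
      \<le> ereal (ln (real k)) / ereal (- ln r)"
    using l by (intro ereal_divide_right_mono) auto
  also have "\<dots> = ereal (ln (real k) / (- ln r))"
    using l by simp
  also have "\<dots> \<le> ereal (ln b / ln r + \<epsilon>)"
  proof -
    have "ln (real k * b) \<le> ln (r powr - \<epsilon>)"
      using k b r by (intro ln_mono) auto
    then have "ln (real k) + ln b \<le> - \<epsilon> * ln r"
      using k b r by (simp add: ln_mult ln_powr)
    then show ?thesis
      using l by (simp add: field_simps)
  qed
  also have "\<dots> = eln (ereal b) / ereal (ln r) + ereal \<epsilon>"
    using b r by (simp add: eln_def)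
  finally show ?thesis .
qed

theorem theorem2:
  fixes M :: "'a measure" and T :: "'a \<Rightarrow> 'a" and f :: "'a \<Rightarrow> real ^ 'n"
  assumes "measure_preserving_system M T"
    and "f \<in> borel_measurable M"
  shows "AE x in M. lower_recurrence_rate T f x \<le> lower_dim_obs M f x \<and>
                    upper_recurrence_rate T f x \<le> upper_dim_obs M f x"
proof -
  interpret measure_preserving_system M T
    by fact
  let ?b = "\<lambda>x r. measure (distr M borel f) (ball (f x) r)"
  \<comment> \<open>A single null set has to serve all \<open>p\<close> and all
    \<open>\<epsilon>\<close>, so \<open>\<epsilon>\<close> first runs through the countably many
    values \<open>1 / real (Suc m)\<close>. Any other positive \<open>\<epsilon>\<close> exceeds one
    of them, and for \<open>r < 1\<close> the bound only weakens as the exponent grows.\<close>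
  have "AE x in M. \<forall>p m. \<forall>\<^sub>F r in at_right 0. \<exists>k>p. f ((T ^^ k) x) \<in> ball (f x) r \<and>
           real k * ?b x r \<le> r powr - (1 / real (Suc m))"
    using return_time_measure_ball[OF assms(2)] by (simp add: AE_all_countable)
  then show ?thesis
  proof eventually_elim
    case (elim x)
    have quotient: "\<forall>\<^sub>F r in at_right 0.
        eln (ereal_of_enat (return_time T f r p x)) / ereal (- ln r)
          \<le> eln (ereal (?b x r)) / ereal (ln r) + ereal \<epsilon>" if "\<epsilon> > 0" for p \<epsilon>
    proof -
      obtain m where m: "1 / real (Suc m) < \<epsilon>"
        using \<open>\<epsilon> > 0\<close> by (metis inverse_eq_divide reals_Archimedean)
      have "\<forall>\<^sub>F r in at_right 0. r \<in> {0<..<1::real}"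
        by (rule eventually_at_right_real) simp
      with elim[rule_format, of p m] show ?thesis
      proof eventually_elim
        case (elim r)
        then obtain k where k: "k > p" "f ((T ^^ k) x) \<in> ball (f x) r"
          "real k * ?b x r \<le> r powr - (1 / real (Suc m))"
          by blast
        note k(3)
        also have "r powr - (1 / real (Suc m)) \<le> r powr - \<epsilon>"
          using elim(2) m by (intro powr_mono') auto
        finally show ?case
          using elim(2) k by (intro recurrence_quotient_le) auto
      qed
    qed
    have "lower_recurrence_rate_from T f p x \<le> lower_dim_obs M f x" for p
    proof (rule ereal_le_epsilon2)
      fix \<epsilon> :: real assume "0 < \<epsilon>"
      from Liminf_mono[OF quotient[OF this]]
      show "lower_recurrence_rate_from T f p x \<le> lower_dim_obs M f x + ereal \<epsilon>"
        by (simp add: lower_recurrence_rate_from_def lower_dim_obs_def lower_pointwise_dim_def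
            Liminf_add_ereal_right)
    qed
    moreover have "upper_recurrence_rate_from T f p x \<le> upper_dim_obs M f x" for p
    proof (rule ereal_le_epsilon2)
      fix \<epsilon> :: real assume "0 < \<epsilon>"
      from Limsup_mono[OF quotient[OF this]]
      show "upper_recurrence_rate_from T f p x \<le> upper_dim_obs M f x + ereal \<epsilon>"
        by (simp add: upper_recurrence_rate_from_def upper_dim_obs_def upper_pointwise_dim_def
            Limsup_add_ereal_right)
    qed
    \<comment> \<open>The dimensions do not depend on \<open>p\<close>, so the bounds survive the
      limit in \<open>p\<close>.\<close>
    ultimately show ?case
      by (intro conjI LIMSEQ_le_const2[OF lower_recurrence_rate_tendsto]
          LIMSEQ_le_const2[OF upper_recurrence_rate_tendsto]) auto
  qed
qed

end
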